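(* Let $p,q$ be complex numbers. The generating function of the products $L_{p,q,n}L_{p,q,2n}$ of $(p,q)$-Lucas numbers is, as a formal power series in $z$, $$\sum_{n=0}^{\infty}L_{p,q,n}L_{p,q,2n}z^n=\frac{4-3p(p^2+2q)z-2q(p^4+3p^2q+2q^2)z^2+pq^3(p^2+2q)z^3}{1-p(p^2+2q)z-q(p^4+3p^2q+2q^2)z^2+pq^3(p^2+2q)z^3+q^6z^4}.$$
   Context: The $(p,q)$-Lucas numbers are defined by $L_{p,q,0}=2$, $L_{p,q,1}=p$, and $L_{p,q,n}=pL_{p,q,n-1}+qL_{p,q,n-2}$ for $n\ge 2$. *)

theory Defs
  imports Complex_Main "HOL-Computational_Algebra.Formal_Power_Series"
begin

fun lucas_pq :: "complex \<Rightarrow> complex \<Rightarrow> nat \<Rightarrow> complex" where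
  "lucas_pq p q 0 = 2"
| "lucas_pq p q (Suc 0) = p"
| "lucas_pq p q (Suc (Suc n)) = p * lucas_pq p q (Suc n) + q * lucas_pq p q n"

end

theory Submission
  imports Defs
begin

text \<open>
  The vectors \<open>(L n, L (n + 1))\<close> and \<open>(L (2n), L (2n + 1))\<close> evolve by \<open>M\<close> and \<open>M\<^sup>2\<close>, where \<open>M\<close> is the
  companion matrix of the Lucas recurrence. The products \<open>L n * L (2n)\<close> therefore satisfy the
  recurrence given by the characteristic polynomial of \<open>M \<otimes> M\<^sup>2\<close>, whose reciprocal is
  the denominator; the numerator is fixed by the first four terms.
\<close>

lemma lucas_pq_product_recurrence:
  "lucas_pq p q (n + 4) * lucas_pq p q (2 * (n + 4)) =
     p * (p^2 + 2 * q) * (lucas_pq p q (n + 3) * lucas_pq p q (2 * (n + 3)))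
   + q * (p^4 + 3 * p^2 * q + 2 * q^2) * (lucas_pq p q (n + 2) * lucas_pq p q (2 * (n + 2)))
   - p * q^3 * (p^2 + 2 * q) * (lucas_pq p q (n + 1) * lucas_pq p q (2 * (n + 1)))
   - q^6 * (lucas_pq p q n * lucas_pq p q (2 * n))"
proof -
  have n2: "n + 2 = Suc (Suc n)" and n3: "n + 3 = Suc (Suc (Suc n))"
    and n4: "n + 4 = Suc (Suc (Suc (Suc n)))"
    and m1: "2 * (n + 1) = Suc (Suc (2 * n))"
    and m2: "2 * (n + 2) = Suc (Suc (Suc (Suc (2 * n))))"
    and m3: "2 * (n + 3) = Suc (Suc (Suc (Suc (Suc (Suc (2 * n))))))"
    and m4: "2 * (n + 4) = Suc (Suc (Suc (Suc (Suc (Suc (Suc (Suc (2 * n))))))))"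
    by simp_all
  show ?thesis
    unfolding m1 m2 m3 m4
    unfolding n2 n3 n4 Suc_eq_plus1[symmetric, of n] lucas_pq.simps(3)
    by algebra
qed

theorem theorem12:
  fixes p q :: complex
  shows "Abs_fps (\<lambda>n. lucas_pq p q n * lucas_pq p q (2 * n)) =
    (fps_const 4
       - fps_const (3 * p * (p^2 + 2 * q)) * fps_X
       - fps_const (2 * q * (p^4 + 3 * p^2 * q + 2 * q^2)) * fps_X^2
       + fps_const (p * q^3 * (p^2 + 2 * q)) * fps_X^3)
    / (1
       - fps_const (p * (p^2 + 2 * q)) * fps_X
       - fps_const (q * (p^4 + 3 * p^2 * q + 2 * q^2)) * fps_X^2
       + fps_const (p * q^3 * (p^2 + 2 * q)) * fps_X^3
       + fps_const (q^6) * fps_X^4)"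
proof -
  define F where "F = Abs_fps (\<lambda>n. lucas_pq p q n * lucas_pq p q (2 * n))"
  define N where "N = fps_const 4
       - fps_const (3 * p * (p^2 + 2 * q)) * fps_X
       - fps_const (2 * q * (p^4 + 3 * p^2 * q + 2 * q^2)) * fps_X^2
       + fps_const (p * q^3 * (p^2 + 2 * q)) * fps_X^3"
  define D where "D = 1
       - fps_const (p * (p^2 + 2 * q)) * fps_X
       - fps_const (q * (p^4 + 3 * p^2 * q + 2 * q^2)) * fps_X^2
       + fps_const (p * q^3 * (p^2 + 2 * q)) * fps_X^3
       + fps_const (q^6) * fps_X^4"
  \<comment> \<open>Multiplying by \<open>fps_X ^ k\<close> shifts coefficients by \<open>k\<close>;
    the tests \<open>n < k\<close> guard against truncated subtraction.\<close>
  have coeff_FD: "fps_nth (F * D) n = fps_nth F n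
      - p * (p^2 + 2 * q) * (if n < 1 then 0 else fps_nth F (n - 1))
      - q * (p^4 + 3 * p^2 * q + 2 * q^2) * (if n < 2 then 0 else fps_nth F (n - 2))
      + p * q^3 * (p^2 + 2 * q) * (if n < 3 then 0 else fps_nth F (n - 3))
      + q^6 * (if n < 4 then 0 else fps_nth F (n - 4))" for n
  proof -
    \<comment> \<open>Writing \<open>fps_X ^ 1\<close> lets the linear term use the same shift rule
      as the others.\<close>
    have "F * D = F - fps_const (p * (p^2 + 2 * q)) * (F * fps_X ^ 1)
       - fps_const (q * (p^4 + 3 * p^2 * q + 2 * q^2)) * (F * fps_X^2)
       + fps_const (p * q^3 * (p^2 + 2 * q)) * (F * fps_X^3)
       + fps_const (q^6) * (F * fps_X^4)"
      unfolding D_def by (simp only: power_one_right ring_distribs mult_1_right mult_ac)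
    then show ?thesis
      by (simp only: fps_add_nth fps_sub_nth fps_mult_left_const_nth fps_X_power_mult_right_nth)
  qed
  have first_coeffs: "fps_nth (F * D) 0 = fps_nth N 0" "fps_nth (F * D) 1 = fps_nth N 1"
    "fps_nth (F * D) 2 = fps_nth N 2" "fps_nth (F * D) 3 = fps_nth N 3"
    \<comment> \<open>Numerals become \<open>Suc\<close> terms so that the recursion evaluates the
      values up to \<open>L 6\<close>.\<close>
    unfolding coeff_FD
    by (simp_all add: F_def N_def fps_X_power_nth eval_nat_numeral) algebra+
  have "fps_nth (F * D) n = fps_nth N n" for n
  proof -
    consider "n = 0" | "n = 1" | "n = 2" | "n = 3" | m where "n = m + 4"
    proof (cases "n < 4")
      case True
      then have "n = 0 \<or> n = 1 \<or> n = 2 \<or> n = 3" by linarith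
      with that show ?thesis by blast
    next
      case False
      then have "n = (n - 4) + 4" by linarith
      with that show ?thesis by blast
    qed
    then show ?thesis
    proof cases
      case 5
      have idx: "m + 4 - 1 = m + 3" "m + 4 - 2 = m + 2" "m + 4 - 3 = m + 1" "m + 4 - 4 = m"
        by simp_all
      \<comment> \<open>From index 4 on all guards are false, and the recurrence cancels the sum;
        \<open>N\<close> has degree at most 3.\<close>
      have "fps_nth (F * D) (m + 4) = 0"
        unfolding coeff_FD idx
        unfolding F_def fps_nth_Abs_fps lucas_pq_product_recurrence[of p q m]
        by simp
      moreover have "fps_nth N (m + 4) = 0"
        by (simp add: N_def fps_X_power_nth fps_X_nth)
      ultimately show ?thesis
        using 5 by simp
    qed (use first_coeffs in blast)+
  qed
  then have "N = F * D"
    by (simp add: fps_eq_iff)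
  \<comment> \<open>The constant term is 1, so \<open>D\<close> is nonzero and cancels in
    \<open>F * D / D\<close>.\<close>
  moreover have "fps_nth D 0 \<noteq> 0"
    by (simp add: D_def)
  ultimately have "N / D = F"
    by (metis fps_nonzero_nth nonzero_mult_div_cancel_right)
  then show ?thesis
    by (simp only: F_def N_def D_def)
qed

end
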